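(* Let $m,n,s$ be integers with $2\le 2s\le m\le n$. For $\delta\in(0,1)$ define $$q_{\max}(\delta;m,n,s):=\inf\{\,q_s(\mathbf A):\ \mathbf A\in\mathbb R^{m\times n},\ \delta_{2s}(\mathbf A)\le\delta\,\}.$$ Then $$\liminf_{\delta\to1-}\frac{q_{\max}(\delta;m,n,s)}{1-\delta}\ \ge\ \frac e4 .$$
   Context: For $\mathbf x=(x_1,\dots,x_n)^T\in\mathbb R^n$, $\|\mathbf x\|_0$ is the number of nonzero components and $\|\mathbf x\|_q=(|x_1|^q+\cdots+|x_n|^q)^{1/q}$ for $0<q<\infty$. $\Sigma_s$ is the set of $s$-sparse vectors, i.e. $\mathbf x\in\mathbb R^n$ with $\|\mathbf x\|_0\le s$. The restricted isometry constant $\delta_k(\mathbf A)$ of order $k$ is the smallest $\delta\ge0$ such that $(1-\delta)\|\mathbf x\|_2^2\le\|\mathbf A\mathbf x\|_2^2\le(1+\delta)\|\mathbf x\|_2^2$ for all $\mathbf x\in\Sigma_k$. For an $m\times n$ matrix $\mathbf A$, $q_s(\mathbf A)$ is the supremum of all $q\in[0,1]$ such that any vector $\mathbf x\in\Sigma_s$ can be exactly recovered by solving the problem $\min\|\mathbf y\|_q$ subject to $\mathbf A\mathbf y=\mathbf A\mathbf x$, where exactly recovered means that $\mathbf x$ is the unique solution of this problem over $\mathbf y\in\mathbb R^n$. *)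

theory Defs
  imports "HOL-Analysis.Analysis"
begin

text \<open>
  An \<open>m \<times> n\<close> real matrix is an element of \<^typ>\<open>real ^ 'n ^ 'm\<close>, with \<open>m = CARD('m)\<close> and
  \<open>n = CARD('n)\<close>; the \<open>2\<close>-norm is the library's \<^const>\<open>norm\<close>.
\<close>

definition l0_norm :: "real ^ 'n \<Rightarrow> nat" where
  "l0_norm x = card {i. x $ i \<noteq> 0}"

definition lq_norm :: "real \<Rightarrow> real ^ 'n \<Rightarrow> real" where
  "lq_norm q x =
     (if q = 0 then real (l0_norm x) else (\<Sum>i\<in>UNIV. \<bar>x $ i\<bar> powr q) powr (1 / q))"

definition sparse :: "nat \<Rightarrow> (real ^ 'n) set" where
  "sparse s = {x. l0_norm x \<le> s}"

definition rip_bound :: "nat \<Rightarrow> real ^ 'n ^ 'm \<Rightarrow> real \<Rightarrow> bool" where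
  "rip_bound k A \<delta> \<longleftrightarrow> 0 \<le> \<delta> \<and>
     (\<forall>x\<in>sparse k. (1 - \<delta>) * (norm x)\<^sup>2 \<le> (norm (A *v x))\<^sup>2 \<and>
                   (norm (A *v x))\<^sup>2 \<le> (1 + \<delta>) * (norm x)\<^sup>2)"

definition ric :: "nat \<Rightarrow> real ^ 'n ^ 'm \<Rightarrow> real" where
  "ric k A = (LEAST \<delta>. rip_bound k A \<delta>)"

text \<open>The minimum defining \<open>ric\<close> is attained.\<close>

lemma rip_bound_ric: "rip_bound k A (ric k A)"
  and ric_le: "rip_bound k A \<delta> \<Longrightarrow> ric k A \<le> \<delta>"
  for A :: "real ^ 'n ^ 'm"
proof -
  let ?S = "{\<delta>. rip_bound k A \<delta>}"
  have eq: "?S = {0..} \<inter> (\<Inter>x\<in>sparse k. {\<delta>. (1 - \<delta>) * (norm x)\<^sup>2 \<le> (norm (A *v x))\<^sup>2} \<inter>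
               {\<delta>. (norm (A *v x))\<^sup>2 \<le> (1 + \<delta>) * (norm x)\<^sup>2})"
    by (auto simp: rip_bound_def)
  have "closed ?S"
    unfolding eq by (intro closed_Int closed_INT ballI closed_Collect_le closed_atLeast continuous_intros)
  moreover have "?S \<noteq> {}"
  proof -
    obtain K where K: "K > 0" "\<And>x. norm (A *v x) \<le> norm x * K"
      using bounded_linear.pos_bounded[OF matrix_vector_mul_bounded_linear] by blast
    have "rip_bound k A (1 + K\<^sup>2)"
      unfolding rip_bound_def
    proof (intro conjI ballI)
      fix x :: "real ^ 'n"
      have "(1 - (1 + K\<^sup>2)) * (norm x)\<^sup>2 \<le> 0"
        by (simp add: mult_nonpos_nonneg)
      then show "(1 - (1 + K\<^sup>2)) * (norm x)\<^sup>2 \<le> (norm (A *v x))\<^sup>2"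
        by (rule order_trans) simp
      have "(norm (A *v x))\<^sup>2 \<le> (norm x * K)\<^sup>2"
        by (intro power_mono K) simp
      also have "\<dots> \<le> (1 + (1 + K\<^sup>2)) * (norm x)\<^sup>2"
        by (simp add: power_mult_distrib algebra_simps)
      finally show "(norm (A *v x))\<^sup>2 \<le> (1 + (1 + K\<^sup>2)) * (norm x)\<^sup>2" .
    qed simp
    then show ?thesis by blast
  qed
  moreover have bdd: "bdd_below ?S"
    by (rule bdd_belowI[of _ 0]) (simp add: rip_bound_def)
  ultimately have "Inf ?S \<in> ?S"
    by (intro closed_contains_Inf)
  then have Inf: "rip_bound k A (Inf ?S)" by simp
  have le: "Inf ?S \<le> \<delta>" if "rip_bound k A \<delta>" for \<delta>
    using that bdd by (intro cInf_lower) auto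
  have "ric k A = Inf ?S"
    unfolding ric_def using Inf le by (intro Least_equality) auto
  with Inf le show "rip_bound k A (ric k A)" "rip_bound k A \<delta> \<Longrightarrow> ric k A \<le> \<delta>"
    by simp_all
qed

definition exactly_recovers :: "real ^ 'n ^ 'm \<Rightarrow> real \<Rightarrow> real ^ 'n \<Rightarrow> bool" where
  "exactly_recovers A q x \<longleftrightarrow> {y. is_arg_min (lq_norm q) (\<lambda>z. A *v z = A *v x) y} = {x}"

definition recovery_exponents :: "nat \<Rightarrow> real ^ 'n ^ 'm \<Rightarrow> real set" where
  "recovery_exponents s A = {q \<in> {0..1}. \<forall>x\<in>sparse s. exactly_recovers A q x}"

definition q_s :: "nat \<Rightarrow> real ^ 'n ^ 'm \<Rightarrow> real" where
  "q_s s A = Sup (recovery_exponents s A)"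

text \<open>
  The value of \<open>Sup {} :: real\<close> never matters below: the set of exponents contains \<open>0\<close>
  whenever the restricted isometry constant of order \<open>2 s\<close> is less than \<open>1\<close>.
\<close>

lemma zero_in_recovery_exponents:
  fixes A :: "real ^ 'n ^ 'm"
  assumes "ric (2 * s) A < 1"
  shows "0 \<in> recovery_exponents s A"
proof -
  have uniq: "y = x" if x: "x \<in> sparse s" and Ay: "A *v y = A *v x"
    and le: "l0_norm y \<le> l0_norm x" for x y :: "real ^ 'n"
  proof -
    have "card {i. (y - x) $ i \<noteq> 0} \<le> card ({i. y $ i \<noteq> 0} \<union> {i. x $ i \<noteq> 0})"
      by (intro card_mono) auto
    also have "\<dots> \<le> card {i. y $ i \<noteq> 0} + card {i. x $ i \<noteq> 0}"
      by (rule card_Un_le)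
    finally have "y - x \<in> sparse (2 * s)"
      using x le by (simp add: sparse_def l0_norm_def)
    then have "(1 - ric (2 * s) A) * (norm (y - x))\<^sup>2 \<le> (norm (A *v (y - x)))\<^sup>2"
      using rip_bound_ric[of "2 * s" A] by (simp add: rip_bound_def)
    also have "\<dots> = 0"
      using Ay by (simp add: matrix_vector_mult_diff_distrib)
    finally show "y = x"
      using assms by (simp add: mult_le_0_iff)
  qed
  have "exactly_recovers A 0 x" if x: "x \<in> sparse s" for x
    unfolding exactly_recovers_def is_arg_min_def lq_norm_def
    using uniq[OF x] by (auto simp: not_less) (metis less_imp_le order_refl not_less)+
  then show ?thesis
    by (simp add: recovery_exponents_def)
qed

text \<open>
  The infimum is taken in \<^typ>\<open>ereal\<close>, so that \<open>inf {} = \<infinity>\<close>; this concerns only those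
  \<open>\<delta>\<close> for which no matrix of the given size satisfies \<open>ric (2 * s) A \<le> \<delta>\<close>.
\<close>

definition q_max :: "'m::finite itself \<Rightarrow> 'n::finite itself \<Rightarrow> nat \<Rightarrow> real \<Rightarrow> ereal" where
  "q_max _ _ s \<delta> = Inf {ereal (q_s s A) | A :: real ^ 'n ^ 'm. ric (2 * s) A \<le> \<delta>}"

end

theory Submission
  imports Defs "HOL-Real_Asymp.Real_Asymp"
begin

text \<open>
  Let \<open>h \<noteq> 0\<close> be a kernel vector violating the null space property of exponent \<open>q\<close> and order
  \<open>s\<close>, and let \<open>T\<close> consist of \<open>2 s\<close> positions of largest magnitude. Comparing the
  \<open>s\<close> terms on one side with at least \<open>s + 1\<close> on the other shows that outside \<open>T\<close> all entries
  are at most \<open>(s / (s + 1)) powr (1 / q)\<close> times the largest entry \<open>M\<close>. Since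
  \<open>A\<close> maps the restrictions of \<open>h\<close> to \<open>T\<close> and to its complement to opposite vectors, the
  restricted isometry property gives \<open>1 - \<delta> \<le> 2 n\<^sup>2 (s / (s + 1)) powr (2 / q)\<close>. For
  \<open>q = c (1 - \<delta>)\<close> the right-hand side is exponentially small in \<open>1 / (1 - \<delta>)\<close>, so this fails
  for \<open>\<delta>\<close> close to \<open>1\<close>, whatever the constant \<open>c\<close>; thus the lower limit is in fact infinite.
\<close>

text \<open>Dividing by \<open>a + b\<close> reduces this to \<open>x \<le> x powr q\<close> on the
  unit interval. It serves as the triangle inequality for sums of \<open>q\<close>-th powers when
  \<open>q \<le> 1\<close>.\<close>

lemma powr_add_le:
  fixes a b q :: real
  assumes "0 \<le> a" "0 \<le> b" "0 < q" "q \<le> 1"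
  shows "(a + b) powr q \<le> a powr q + b powr q"
proof (cases "a + b = 0")
  case True
  with assms show ?thesis by simp
next
  case False
  then have pos: "a + b > 0" using assms by simp
  have le: "x \<le> x powr q" if "0 \<le> x" "x \<le> 1" for x :: real
    using powr_mono'[of q 1 x] that assms by simp
  have "1 = a / (a + b) + b / (a + b)"
    using pos by (simp flip: add_divide_distrib)
  also have "\<dots> \<le> (a / (a + b)) powr q + (b / (a + b)) powr q"
    using assms pos by (intro add_mono le) auto
  also have "\<dots> = (a powr q + b powr q) / (a + b) powr q"
    using assms pos by (simp add: powr_divide add_divide_distrib)
  finally show ?thesis
    using pos by (simp add: le_divide_eq)
qed

lemma exists_largest_subset:
  fixes f :: "'a \<Rightarrow> 'b::linorder"
  assumes "finite A" "k \<le> card A"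
  shows "\<exists>T\<subseteq>A. card T = k \<and> (\<forall>i\<in>T. \<forall>j\<in>A - T. f j \<le> f i)"
  using assms(2)
proof (induction k)
  case 0
  then show ?case by (intro exI[of _ "{}"]) simp
next
  case (Suc k)
  then obtain T where T: "T \<subseteq> A" "card T = k" "\<forall>i\<in>T. \<forall>j\<in>A - T. f j \<le> f i"
    by auto
  have finT: "finite T" using T assms finite_subset by blast
  have ne: "A - T \<noteq> {}"
    using T Suc.prems finT by (metis Diff_eq_empty_iff card_mono not_less_eq_eq)
  define M where "M = Max (f ` (A - T))"
  have "M \<in> f ` (A - T)"
    unfolding M_def using ne assms by (intro Max_in) auto
  then obtain a where a: "a \<in> A - T" "f a = M" by auto
  have "f j \<le> f a" if "j \<in> A - T" for j
    using that assms a(2) by (simp add: M_def)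
  then show ?case
    using T a finT by (intro exI[of _ "insert a T"]) auto
qed

definition null_space_property :: "real \<Rightarrow> nat \<Rightarrow> real ^ 'n ^ 'm \<Rightarrow> bool" where
  "null_space_property q s A \<longleftrightarrow> (\<forall>h S. A *v h = 0 \<longrightarrow> h \<noteq> 0 \<longrightarrow> card S \<le> s \<longrightarrow>
     (\<Sum>i\<in>S. \<bar>h $ i\<bar> powr q) < (\<Sum>i\<in>-S. \<bar>h $ i\<bar> powr q))"

text \<open>Off the support \<open>S\<close> of \<open>x\<close>, a competitor \<open>y\<close>
  equals \<open>h = y - x\<close>. Passing from \<open>x\<close> to \<open>y\<close> thus loses on
  \<open>S\<close> at most the mass of \<open>h\<close> there, by subadditivity, and gains off
  \<open>S\<close> its mass there, which is strictly larger.\<close>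

lemma null_space_property_imp_recovery:
  fixes A :: "real ^ 'n ^ 'm"
  assumes "null_space_property q s A" "0 < q" "q \<le> 1"
  shows "q \<in> recovery_exponents s A"
proof -
  have less: "lq_norm q x < lq_norm q y" if x: "x \<in> sparse s" and Ay: "A *v y = A *v x" and "y \<noteq> x"
    for x y :: "real ^ 'n"
  proof -
    define h S where "h = y - x" and "S = {i. x $ i \<noteq> 0}"
    have yS: "y $ i = h $ i" if "i \<in> -S" for i
      using that by (simp add: h_def S_def)
    have "(\<Sum>i\<in>UNIV. \<bar>x $ i\<bar> powr q) = (\<Sum>i\<in>S. \<bar>x $ i\<bar> powr q)"
      by (rule sum.mono_neutral_right) (auto simp: S_def)
    also have "\<dots> \<le> (\<Sum>i\<in>S. \<bar>y $ i\<bar> powr q + \<bar>h $ i\<bar> powr q)"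
    proof (rule sum_mono)
      fix i
      have "\<bar>x $ i\<bar> powr q \<le> (\<bar>y $ i\<bar> + \<bar>h $ i\<bar>) powr q"
        using assms by (intro powr_mono2) (auto simp: h_def)
      also have "\<dots> \<le> \<bar>y $ i\<bar> powr q + \<bar>h $ i\<bar> powr q"
        using assms by (intro powr_add_le) auto
      finally show "\<bar>x $ i\<bar> powr q \<le> \<bar>y $ i\<bar> powr q + \<bar>h $ i\<bar> powr q" .
    qed
    also have "\<dots> < (\<Sum>i\<in>S. \<bar>y $ i\<bar> powr q) + (\<Sum>i\<in>-S. \<bar>h $ i\<bar> powr q)"
    proof -
      have "A *v h = 0" "h \<noteq> 0" "card S \<le> s"
        using x Ay \<open>y \<noteq> x\<close>
        by (simp_all add: h_def S_def sparse_def l0_norm_def matrix_vector_mult_diff_distrib)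
      then have "(\<Sum>i\<in>S. \<bar>h $ i\<bar> powr q) < (\<Sum>i\<in>-S. \<bar>h $ i\<bar> powr q)"
        using assms(1) by (simp add: null_space_property_def)
      then show ?thesis by (simp add: sum.distrib)
    qed
    also have "\<dots> = (\<Sum>i\<in>S. \<bar>y $ i\<bar> powr q) + (\<Sum>i\<in>-S. \<bar>y $ i\<bar> powr q)"
      using yS by simp
    also have "\<dots> = (\<Sum>i\<in>UNIV. \<bar>y $ i\<bar> powr q)"
      by (subst sum.union_disjoint [symmetric]) auto
    finally show ?thesis
      using assms by (auto simp: lq_norm_def intro!: powr_less_mono2 sum_nonneg)
  qed
  have "exactly_recovers A q x" if x: "x \<in> sparse s" for x
    unfolding exactly_recovers_def is_arg_min_def
    using less[OF x] by (auto dest: less_asym)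
  then show ?thesis
    using assms by (simp add: recovery_exponents_def)
qed

lemma null_space_property_violation_decay:
  fixes h :: "real ^ 'n" and T S :: "'n set" and M q :: real
  assumes viol: "(\<Sum>i\<in>-S. \<bar>h $ i\<bar> powr q) \<le> (\<Sum>i\<in>S. \<bar>h $ i\<bar> powr q)"
    and S: "card S \<le> s" and T: "card T = 2 * s" and j: "j \<notin> T"
    and large: "\<And>i. i \<in> T \<Longrightarrow> \<bar>h $ j\<bar> \<le> \<bar>h $ i\<bar>"
    and M: "\<And>i. \<bar>h $ i\<bar> \<le> M" and q: "0 < q"
  shows "\<bar>h $ j\<bar> \<le> (s / (s + 1)) powr (1 / q) * M"
proof -
  have M0: "0 \<le> M" using M[of j] by linarith
  \<comment> \<open>The extra index \<open>j\<close> matters: \<open>2 * s + 1\<close> positions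
    minus at most \<open>s\<close> leave \<open>s + 1\<close>, not \<open>s\<close>, which makes the
    ratio \<open>s / (s + 1)\<close> strictly less than 1.\<close>
  have "card (insert j T - S) \<ge> s + 1"
    using diff_card_le_card_Diff[of S "insert j T"] S T j by simp
  then have "(s + 1) * \<bar>h $ j\<bar> powr q \<le> card (insert j T - S) * \<bar>h $ j\<bar> powr q"
    by (intro mult_right_mono) (auto simp flip: of_nat_Suc)
  also have "\<dots> = (\<Sum>i\<in>insert j T - S. \<bar>h $ j\<bar> powr q)"
    by simp
  also have "\<dots> \<le> (\<Sum>i\<in>insert j T - S. \<bar>h $ i\<bar> powr q)"
    using large q by (intro sum_mono powr_mono2) auto
  also have "\<dots> \<le> (\<Sum>i\<in>-S. \<bar>h $ i\<bar> powr q)"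
    by (intro sum_mono2) auto
  also have "\<dots> \<le> (\<Sum>i\<in>S. \<bar>h $ i\<bar> powr q)"
    by (fact viol)
  also have "\<dots> \<le> (\<Sum>i\<in>S. M powr q)"
    using M q by (intro sum_mono powr_mono2) auto
  also have "\<dots> \<le> s * M powr q"
    using S by (simp add: mult_right_mono)
  finally have "\<bar>h $ j\<bar> powr q \<le> s / (s + 1) * M powr q"
    by (simp add: field_simps)
  then have "(\<bar>h $ j\<bar> powr q) powr (1 / q) \<le> (s / (s + 1) * M powr q) powr (1 / q)"
    using q by (intro powr_mono2) auto
  also have "\<dots> = (s / (s + 1)) powr (1 / q) * (M powr q) powr (1 / q)"
    by (intro powr_mult)
  finally show ?thesis
    using q M0 by (simp add: powr_powr add.commute)
qed

text \<open>As \<open>v\<close> need not be sparse, the isometry bound is not applied to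
  \<open>v\<close> but to each unit vector: every column of \<open>A\<close> has norm at most
  \<open>sqrt (1 + \<delta>)\<close>, hence at most \<open>sqrt 2\<close>. The triangle inequality
  over the columns does the rest.\<close>

lemma norm_matrix_vector_le_of_rip:
  fixes A :: "real ^ 'n ^ 'm" and v :: "real ^ 'n"
  assumes rip: "rip_bound k A \<delta>" and "\<delta> \<le> 1" "1 \<le> k" and B: "\<And>j. \<bar>v $ j\<bar> \<le> B"
  shows "norm (A *v v) \<le> CARD('n) * (sqrt 2 * B)"
proof -
  have col: "norm (column j A) \<le> sqrt 2" for j
  proof -
    have "{i. (axis j 1 :: real ^ 'n) $ i \<noteq> 0} = {j}"
      by (auto simp: axis_def)
    then have "(axis j 1 :: real ^ 'n) \<in> sparse k"
      using assms by (simp add: sparse_def l0_norm_def)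
    then have "(norm (A *v axis j 1))\<^sup>2 \<le> (1 + \<delta>) * (norm (axis j 1 :: real ^ 'n))\<^sup>2"
      using rip unfolding rip_bound_def by blast
    also have "\<dots> \<le> 2"
      using assms by (simp add: norm_axis_1)
    finally show ?thesis
      by (simp add: matrix_vector_mul_component matrix_vector_mult_basis real_le_rsqrt)
  qed
  have "norm (A *v v) = norm (\<Sum>j\<in>UNIV. v $ j *s column j A)"
    by (simp add: matrix_mult_sum)
  also have "\<dots> \<le> (\<Sum>j\<in>(UNIV :: 'n set). sqrt 2 * B)"
  proof (rule sum_norm_le)
    fix j
    have "norm (v $ j *s column j A) = \<bar>v $ j\<bar> * norm (column j A)"
      by (simp add: scalar_mult_eq_scaleR)
    also have "\<dots> \<le> B * sqrt 2"
      using B[of j] col[of j] by (intro mult_mono) auto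
    finally show "norm (v $ j *s column j A) \<le> sqrt 2 * B"
      by (simp add: mult.commute)
  qed
  finally show ?thesis by simp
qed

lemma null_space_property_of_ric:
  fixes A :: "real ^ 'n ^ 'm"
  assumes s: "1 \<le> s" "2 * s \<le> CARD('n)" and ric: "ric (2 * s) A \<le> \<delta>" and "\<delta> \<le> 1"
    and q: "0 < q"
    and small: "2 * (real CARD('n))\<^sup>2 * (s / (s + 1)) powr (2 / q) < 1 - \<delta>"
  shows "null_space_property q s A"
  unfolding null_space_property_def
proof (intro allI impI, rule ccontr)
  fix h :: "real ^ 'n" and S :: "'n set"
  assume Ah: "A *v h = 0" and "h \<noteq> 0" and S: "card S \<le> s"
    and "\<not> (\<Sum>i\<in>S. \<bar>h $ i\<bar> powr q) < (\<Sum>i\<in>-S. \<bar>h $ i\<bar> powr q)"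
  then have viol: "(\<Sum>i\<in>-S. \<bar>h $ i\<bar> powr q) \<le> (\<Sum>i\<in>S. \<bar>h $ i\<bar> powr q)"
    by simp
  let ?r = "real s / (real s + 1)"
  define \<delta>' where "\<delta>' = ric (2 * s) A"
  have rip: "rip_bound (2 * s) A \<delta>'"
    by (simp add: \<delta>'_def rip_bound_ric)
  obtain T :: "'n set" where T: "card T = 2 * s"
    and large: "\<And>i j. i \<in> T \<Longrightarrow> j \<notin> T \<Longrightarrow> \<bar>h $ j\<bar> \<le> \<bar>h $ i\<bar>"
    using exists_largest_subset[of "UNIV :: 'n set" "2 * s" "\<lambda>i. \<bar>h $ i\<bar>"] s by auto
  have fT: "finite T" "T \<noteq> {}" using T s by auto
  define M where "M = Max ((\<lambda>i. \<bar>h $ i\<bar>) ` T)"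
  have "M \<in> (\<lambda>i. \<bar>h $ i\<bar>) ` T"
    unfolding M_def using fT by (intro Max_in) auto
  then obtain a where a: "a \<in> T" "\<bar>h $ a\<bar> = M" by auto
  have M: "\<bar>h $ i\<bar> \<le> M" for i
    using large[OF a(1), of i] a(2) fT by (cases "i \<in> T") (auto simp: M_def)
  have "M > 0"
    using \<open>h \<noteq> 0\<close> M by (auto simp: vec_eq_iff) (meson less_le_trans zero_less_abs_iff)
  define B where "B = ?r powr (1 / q) * M"
  have tail: "\<bar>h $ j\<bar> \<le> B" if "j \<notin> T" for j
    unfolding B_def
    using null_space_property_violation_decay[OF viol S T that large[OF _ that] M q] .
  define u v :: "real ^ 'n"
    where "u = (\<chi> i. if i \<in> T then h $ i else 0)" and "v = (\<chi> i. if i \<in> T then 0 else h $ i)"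
  have "h = u + v"
    by (simp add: u_def v_def vec_eq_iff)
  with Ah have "A *v u = - (A *v v)"
    by (simp add: matrix_vector_right_distrib eq_neg_iff_add_eq_0)
  then have eq: "norm (A *v u) = norm (A *v v)" by simp
  have "card {i. u $ i \<noteq> 0} \<le> card T"
    by (intro card_mono) (auto simp: u_def)
  then have "u \<in> sparse (2 * s)"
    using T by (simp add: sparse_def l0_norm_def)
  have "M \<le> norm u"
    using component_le_norm_cart[of u a] a by (simp add: u_def)
  \<comment> \<open>The kernel equation is now squeezed: the sparse head \<open>u\<close>, which
    contains the entry of size \<open>M\<close>, bounds the common norm from below, and the small
    entries of the tail \<open>v\<close> bound it from above.\<close>
  then have "(1 - \<delta>) * M\<^sup>2 \<le> (1 - \<delta>') * (norm u)\<^sup>2"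
    using ric \<open>\<delta> \<le> 1\<close> \<open>M > 0\<close> by (intro mult_mono power_mono) (auto simp: \<delta>'_def)
  also have "\<dots> \<le> (norm (A *v v))\<^sup>2"
    using rip \<open>u \<in> sparse (2 * s)\<close> by (simp add: rip_bound_def flip: eq)
  also have "norm (A *v v) \<le> CARD('n) * (sqrt 2 * B)"
    using rip ric s \<open>\<delta> \<le> 1\<close> tail \<open>M > 0\<close>
    by (intro norm_matrix_vector_le_of_rip[of "2 * s" _ \<delta>']) (auto simp: \<delta>'_def v_def B_def)
  then have "(norm (A *v v))\<^sup>2 \<le> (CARD('n) * (sqrt 2 * B))\<^sup>2"
    by (intro power_mono) auto
  \<comment> \<open>Squaring doubles the exponent \<open>1 / q\<close> and produces the factor
    \<open>2\<close> from \<open>sqrt 2\<close>; the remaining \<open>M\<^sup>2\<close> cancels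
    against the left-hand side.\<close>
  also have "\<dots> = 2 * (real CARD('n))\<^sup>2 * ?r powr (2 / q) * M\<^sup>2"
  proof -
    have "(?r powr (1 / q))\<^sup>2 = ?r powr (2 / q)"
      by (simp add: power2_eq_square flip: powr_add)
    then show ?thesis
      by (simp add: B_def power_mult_distrib)
  qed
  finally have "1 - \<delta> \<le> 2 * (real CARD('n))\<^sup>2 * ?r powr (2 / q)"
    using \<open>M > 0\<close> by simp
  with small show False by simp
qed

text \<open>The smallness condition depends on \<open>A\<close> only through its number of columns,
  so the same exponent \<open>q\<close> works for every admissible matrix and survives the infimum.
  If there is no such matrix, the infimum is infinite.\<close>

lemma q_max_ge:
  assumes "1 \<le> s" "2 * s \<le> CARD('n::finite)" "\<delta> \<le> 1" "0 < q" "q \<le> 1"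
    and "2 * (real CARD('n))\<^sup>2 * (s / (s + 1)) powr (2 / q) < 1 - \<delta>"
  shows "ereal q \<le> q_max TYPE('m::finite) TYPE('n) s \<delta>"
proof -
  have "q \<le> q_s s A" if "ric (2 * s) A \<le> \<delta>" for A :: "real ^ 'n ^ 'm"
  proof -
    have "q \<in> recovery_exponents s A"
      using assms that by (intro null_space_property_imp_recovery null_space_property_of_ric) auto
    moreover have "bdd_above (recovery_exponents s A)"
      by (rule bdd_aboveI[of _ 1]) (auto simp: recovery_exponents_def)
    ultimately show ?thesis
      unfolding q_s_def by (intro cSup_upper)
  qed
  then show ?thesis
    unfolding q_max_def by (intro Inf_greatest) auto
qed

lemma eventually_exponentially_small:
  fixes C c r :: real
  assumes "0 < c" "0 < r" "r < 1" "0 < C"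
  shows "eventually (\<lambda>\<delta>. C * r powr (2 / (c * (1 - \<delta>))) < 1 - \<delta>) (at_left 1)"
proof -
  \<comment> \<open>With this \<open>K\<close>, positive because \<open>r < 1\<close>, the power
    becomes \<open>exp (- (K / (1 - \<delta>)))\<close>, which decays faster than
    \<open>1 - \<delta>\<close> as \<delta> tends to 1 from below.\<close>
  define K where "K = - (2 * ln r / c)"
  have "K > 0" using assms by (simp add: K_def divide_neg_pos mult_pos_neg)
  have "r powr (2 / (c * (1 - \<delta>))) = exp (- (K / (1 - \<delta>)))" for \<delta>
    using assms by (simp add: powr_def K_def)
  moreover have "eventually (\<lambda>\<delta>. C * exp (- (K / (1 - \<delta>))) < 1 - \<delta>) (at_left 1)"
    using \<open>K > 0\<close> \<open>0 < C\<close> by real_asymp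
  ultimately show ?thesis by simp
qed

theorem theorem1p3:
  fixes s :: nat
  assumes "2 \<le> 2 * s" and "2 * s \<le> CARD('m::finite)" and "CARD('m) \<le> CARD('n::finite)"
  shows "Liminf (at_left (1::real)) (\<lambda>\<delta>. q_max TYPE('m) TYPE('n) s \<delta> / ereal (1 - \<delta>))
           \<ge> ereal (exp 1 / 4)"
proof (rule Liminf_bounded)
  let ?c = "exp 1 / 4 :: real"
  have "eventually (\<lambda>\<delta>. 2 * (real CARD('n))\<^sup>2 * (s / (s + 1)) powr (2 / (?c * (1 - \<delta>))) < 1 - \<delta>)
          (at_left 1)"
    using assms by (intro eventually_exponentially_small) auto
  \<comment> \<open>The exponent used is \<open>q = ?c * (1 - \<delta>)\<close>; it must lie in the
    unit interval to count as a recovery exponent.\<close>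
  moreover have "eventually (\<lambda>\<delta>. ?c * (1 - \<delta>) \<le> 1) (at_left 1)"
    by real_asymp
  moreover have "eventually (\<lambda>\<delta>::real. \<delta> < 1) (at_left 1)"
    by (simp add: eventually_at_filter)
  ultimately show "eventually (\<lambda>\<delta>. ereal ?c \<le> q_max TYPE('m) TYPE('n) s \<delta> / ereal (1 - \<delta>))
      (at_left 1)"
  proof eventually_elim
    case (elim \<delta>)
    then have "ereal (?c * (1 - \<delta>)) \<le> q_max TYPE('m) TYPE('n) s \<delta>"
      using assms by (intro q_max_ge) (auto simp: add.commute)
    then show ?case
      using elim by (simp add: ereal_le_divide_pos mult.commute)
  qed
qed

end
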